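(* For $k\in\{1,2,3,4\}$ let $F_{0,0}(t;k)=\sum_{n\ge 0} f_{0,0}(n,k)\,t^n$ be the generating function (formal power series in $t$) for the number $f_{0,0}(n,k)$ of paths of length $n$ from $(0,0)$ to $(0,0)$ in the directed graph $D_k$. Then $$F_{0,0}(t;1)=\frac{1}{1-t^{3}},$$ $$F_{0,0}(t;2)=\frac{1-3t^{3}}{1-4t^{3}-t^{6}},$$ $$F_{0,0}(t;3)=\frac{1-8t^{3}+5t^{6}-2t^{9}}{1-9t^{3}+9t^{6}-8t^{9}},$$ $$F_{0,0}(t;4)=\frac{1-15t^{3}+48t^{6}-46t^{9}-19t^{12}}{1-16t^{3}+59t^{6}-67t^{9}-37t^{12}+8t^{15}}.$$
   Context: The directed graph $D_k$ has vertex set $V_k=\{(i,j): i,j\in\mathbb{Z}_{\ge 0},\ i+j\le k\}$. There is a directed edge from $(a,b)\in V_k$ to $(c,d)\in V_k$ exactly when $(c,d)$ is one of $(a,b+1)$, $(a-1,b)$, $(a+1,b-1)$. A path of length $n$ in $D_k$ is a sequence of vertices $v_0,v_1,\ldots,v_n$ such that $(v_{l},v_{l+1})$ is a directed edge for each $0\le l<n$; vertices may repeat. *)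

theory Defs
  imports
    "HOL-Computational_Algebra.Formal_Power_Series"
    "Graph_Theory.Pair_Digraph"
    "Graph_Theory.Vertex_Walk"
begin

definition V :: "nat \<Rightarrow> (int \<times> int) set" where
  "V k = {(i, j). 0 \<le> i \<and> 0 \<le> j \<and> i + j \<le> int k}"

definition D :: "nat \<Rightarrow> (int \<times> int) pair_pre_digraph" where
  "D k = \<lparr> pverts = V k,
           parcs = {((a, b), (c, d)). (a, b) \<in> V k \<and> (c, d) \<in> V k \<and>
                      (c, d) \<in> {(a, b + 1), (a - 1, b), (a + 1, b - 1)}} \<rparr>"

text \<open>Paths may repeat vertices, so they are the vertex walks (\<^const>\<open>vwalk\<close>) of the
  library, whose \<^const>\<open>vpath\<close> demands distinct vertices.\<close>

definition paths :: "nat \<Rightarrow> int \<times> int \<Rightarrow> int \<times> int \<Rightarrow> nat \<Rightarrow> (int \<times> int) list set" where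
  "paths k u v n = {p. vwalk p (with_proj (D k)) \<and> vwalk_length p = n \<and> hd p = u \<and> last p = v}"

definition f00 :: "nat \<Rightarrow> nat \<Rightarrow> nat" where
  "f00 n k = card (paths k (0, 0) (0, 0) n)"

definition F00 :: "nat \<Rightarrow> rat fps" where
  "F00 k = Abs_fps (\<lambda>n. of_nat (f00 n k))"

lemma finite_V: "finite (V k)"
proof (rule finite_subset)
  show "V k \<subseteq> {0..int k} \<times> {0..int k}"
    by (auto simp: V_def)
qed simp

lemma finite_paths: "finite (paths k u v n)"
proof (rule finite_subset)
  show "paths k u v n \<subseteq> {p. set p \<subseteq> V k \<and> length p \<le> Suc n}"
    by (auto simp: paths_def vwalk_def D_def)
  show "finite {p. set p \<subseteq> V k \<and> length p \<le> Suc n}"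
    by (rule finite_lists_length_le[OF finite_V])
qed

lemma paths_iff:
  "p \<in> paths k u v n \<longleftrightarrow>
     length p = Suc n \<and> p ! 0 = u \<and> p ! n = v \<and> (\<forall>l\<le>n. p ! l \<in> V k) \<and>
     (\<forall>l<n. (p ! l, p ! Suc l) \<in> parcs (D k))"
proof -
  have arcs: "set (vwalk_arcs q) = {(q ! l, q ! Suc l) | l. Suc l < length q}"
    for q :: "(int \<times> int) list"
  proof (induction q rule: vwalk_arcs.induct)
    case (3 x y xs)
    have "{((x # y # xs) ! l, (x # y # xs) ! Suc l) | l. Suc l < length (x # y # xs)} =
          insert (x, y) {((y # xs) ! l, (y # xs) ! Suc l) | l. Suc l < length (y # xs)}"
      (is "?A = insert _ ?B")
    proof
      show "?A \<subseteq> insert (x, y) ?B"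
      proof
        fix e assume "e \<in> ?A"
        then obtain l where l: "e = ((x # y # xs) ! l, (x # y # xs) ! Suc l)"
          "Suc l < length (x # y # xs)" by blast
        then show "e \<in> insert (x, y) ?B" by (cases l) auto
      qed
      show "insert (x, y) ?B \<subseteq> ?A"
        by (force intro: exI[of _ "Suc _"])
    qed
    with 3 show ?case by simp
  qed auto
  show ?thesis
  proof (cases "length p = Suc n")
    case True
    then have "p \<noteq> []" by auto
    moreover from this True have "hd p = p ! 0" "last p = p ! n"
      by (simp_all add: hd_conv_nth last_conv_nth)
    moreover from True have "set p = {p ! l | l. l \<le> n}"
      by (simp add: set_conv_nth less_Suc_eq_le)
    moreover from True have "set (vwalk_arcs p) = {(p ! l, p ! Suc l) | l. l < n}"
      by (simp add: arcs)
    moreover have "pverts (D k) = V k"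
      by (simp add: D_def)
    ultimately show ?thesis
      using True by (simp add: paths_def vwalk_def) blast
  next
    case False
    then show ?thesis
      by (cases p) (auto simp: paths_def vwalk_def)
  qed
qed

end

theory Submission
  imports Defs
begin

text \<open>
  Let \<open>W v\<close> be the generating function of the paths from the origin to \<open>v\<close>. Cutting off the last
  edge of a path gives one linear equation per vertex,
  \<open>W v = [v = (0, 0)] + t * (sum of W u over the edges u \<rightarrow> v)\<close>, in which every vertex has at most
  the three predecessors \<open>(c, d - 1)\<close>, \<open>(c + 1, d)\<close>, \<open>(c - 1, d + 1)\<close>. The factor \<open>t\<close> makes
  this system uniquely solvable, since the coefficients of degree \<open>n + 1\<close> are determined by those
  of degree \<open>n\<close> (\<open>walk_gf_unique\<close>).

  Writing \<open>A\<close> for the adjacency matrix, Cramer's rule says that \<open>det (I - t * A) * W v\<close> is a cofactor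
  of \<open>I - t * A\<close>, hence a polynomial. These polynomials can be guessed by multiplying the
  determinant with an initial segment of the series \<open>W v\<close>; once written down, they need no
  justification other than that they satisfy the linear system with the right-hand side scaled
  by the determinant. So a table of numerators, one for each vertex, is a certificate for the
  formula at the origin (\<open>F00_eqI\<close>), and checking it amounts to one polynomial identity per vertex.
  Only powers of \<open>t\<close> in one residue class modulo 3 occur in each entry, because every edge lowers
  \<open>a - b\<close> by 1 modulo 3.
\<close>

unbundle fps_syntax

definition walk_gf :: "nat \<Rightarrow> int \<times> int \<Rightarrow> rat fps" where
  "walk_gf k v = Abs_fps (\<lambda>n. of_nat (card (paths k (0, 0) v n)))"

lemma paths_0: "paths k u v 0 = (if u = v \<and> v \<in> V k then {[v]} else {})"
  by (auto simp: paths_iff length_Suc_conv)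

lemma paths_outside: "v \<notin> V k \<Longrightarrow> paths k u v n = {}"
  by (auto simp: paths_iff)

lemma paths_Suc:
  assumes "(c, d) \<in> V k"
  shows "paths k u (c, d) (Suc n) =
    (\<Union>w\<in>{(c, d - 1), (c + 1, d), (c - 1, d + 1)}. (\<lambda>p. p @ [(c, d)]) ` paths k u w n)"
    (is "?L = ?R")
proof (intro equalityI subsetI)
  fix p assume p: "p \<in> ?L"
  then have len: "length p = Suc (Suc n)" and arc: "(p ! n, p ! Suc n) \<in> parcs (D k)"
    and end_: "p ! Suc n = (c, d)"
    by (auto simp: paths_iff)
  define w where "w = p ! n"
  have w: "w \<in> {(c, d - 1), (c + 1, d), (c - 1, d + 1)}"
    using arc end_ by (cases w) (auto simp: D_def w_def)
  have "butlast p \<in> paths k u w n"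
    using p by (auto simp: paths_iff w_def nth_butlast)
  moreover have "p = butlast p @ [(c, d)]"
    using len end_ by (metis append_butlast_last_id diff_Suc_1 last_conv_nth length_0_conv nat.distinct(1))
  ultimately show "p \<in> ?R"
    using w by blast
next
  fix p assume "p \<in> ?R"
  then obtain w q where w: "w \<in> {(c, d - 1), (c + 1, d), (c - 1, d + 1)}"
    and q: "q \<in> paths k u w n" and p: "p = q @ [(c, d)]"
    by blast
  have "w \<in> V k"
    using q paths_outside by blast
  then have "(w, (c, d)) \<in> parcs (D k)"
    using w assms by (auto simp: D_def)
  then show "p \<in> ?L"
    using q assms by (auto simp: p paths_iff nth_append le_Suc_eq less_Suc_eq)
qed

text \<open>The extensions of paths with different end points are different, because the last but one
  vertex of the extended path remembers the end point.\<close>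

lemma card_paths_Suc:
  assumes "(c, d) \<in> V k"
  shows "card (paths k u (c, d) (Suc n)) =
    card (paths k u (c, d - 1) n) + card (paths k u (c + 1, d) n) + card (paths k u (c - 1, d + 1) n)"
proof -
  let ?S = "{(c, d - 1), (c + 1, d), (c - 1, d + 1)}"
  let ?ext = "\<lambda>w. (\<lambda>p. p @ [(c, d)]) ` paths k u w n"
  have "card (\<Union>w\<in>?S. ?ext w) = (\<Sum>w\<in>?S. card (?ext w))"
  proof (rule card_UN_disjoint)
    show "\<forall>v\<in>?S. \<forall>w\<in>?S. v \<noteq> w \<longrightarrow> ?ext v \<inter> ?ext w = {}"
      by (auto simp: paths_def)
  qed (auto simp: finite_paths)
  also have "\<dots> = (\<Sum>w\<in>?S. card (paths k u w n))"
    by (intro sum.cong refl card_image) (simp add: inj_on_def)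
  finally show ?thesis
    by (simp add: paths_Suc[OF assms])
qed

text \<open>The system is linear, so uniqueness follows from the homogeneous case: a solution with
  right-hand side 0 is divisible by every power of \<open>fps_X\<close>. Requiring \<open>y\<close> to vanish off \<open>V k\<close>
  lets the same equation, with three predecessors, serve for the vertices on the boundary.\<close>

lemma walk_gf_unique:
  assumes outside: "\<And>v. v \<notin> V k \<Longrightarrow> y v = 0"
    and step: "\<And>c d. (c, d) \<in> V k \<Longrightarrow> y (c, d) = (if (c, d) = (0, 0) then q else 0) +
      fps_X * (y (c, d - 1) + y (c + 1, d) + y (c - 1, d + 1))"
  shows "y v = q * walk_gf k v"
proof -
  define z where "z v = y v - q * walk_gf k v" for v
  have z_outside: "z v = 0" if "v \<notin> V k" for v
    using that by (simp add: z_def outside walk_gf_def paths_outside flip: fps_zero_def)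
  have walk_step: "walk_gf k (c, d) = (if (c, d) = (0, 0) then 1 else 0) +
      fps_X * (walk_gf k (c, d - 1) + walk_gf k (c + 1, d) + walk_gf k (c - 1, d + 1))"
    if "(c, d) \<in> V k" for c d
  proof (rule fps_ext)
    fix n
    show "walk_gf k (c, d) $ n = ((if (c, d) = (0, 0) then 1 else 0) +
      fps_X * (walk_gf k (c, d - 1) + walk_gf k (c + 1, d) + walk_gf k (c - 1, d + 1))) $ n"
      using that by (cases n) (auto simp: walk_gf_def paths_0 card_paths_Suc)
  qed
  have z_step: "z (c, d) = fps_X * (z (c, d - 1) + z (c + 1, d) + z (c - 1, d + 1))"
    if "(c, d) \<in> V k" for c d
    using step[OF that] walk_step[OF that] by (simp add: z_def algebra_simps)
  have "z v $ n = 0" for n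
  proof (induction n arbitrary: v)
    case 0
    show ?case
      by (cases v, cases "v \<in> V k") (simp_all add: z_outside z_step)
  next
    case (Suc n)
    then show ?case
      by (cases v, cases "v \<in> V k") (simp_all add: z_outside z_step)
  qed
  then have "z v = 0"
    by (simp add: fps_eq_iff)
  then show ?thesis
    by (simp add: z_def)
qed

definition vertices :: "nat \<Rightarrow> (int \<times> int) list" where
  "vertices k = [(i, j). i \<leftarrow> [0..int k], j \<leftarrow> [0..int k - i]]"

lemma set_vertices: "set (vertices k) = V k"
  by (auto simp: vertices_def V_def image_iff)

definition table_entry :: "((int \<times> int) \<times> rat fps) list \<Rightarrow> int \<times> int \<Rightarrow> rat fps" where
  "table_entry ps v = (case map_of ps v of None \<Rightarrow> 0 | Some p \<Rightarrow> p)"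

lemma table_entry_simps:
  "table_entry [] v = 0"
  "table_entry ((w, p) # ps) v = (if v = w then p else table_entry ps v)"
  by (simp_all add: table_entry_def)

text \<open>As a congruence rule for the simplifier, this keeps it from normalizing all polynomials of
  a table anew at every lookup.\<close>

lemma table_entry_weak_cong: "v = w \<Longrightarrow> table_entry ps v = table_entry ps w"
  by simp

text \<open>Here \<open>ps\<close> lists the polynomials \<open>q * walk_gf k v\<close>. Fixing the order of its keys ensures that
  it has exactly one entry for each vertex, so that the identities can be checked entry by entry
  and cover all of \<open>V k\<close>.\<close>

lemma F00_eqI:
  assumes keys: "map fst ps = vertices k"
    and step: "\<forall>((c, d), p) \<in> set ps. p = (if (c, d) = (0, 0) then q else 0) +
      fps_X * (table_entry ps (c, d - 1) + table_entry ps (c + 1, d) + table_entry ps (c - 1, d + 1))"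
    and nonzero: "q $ 0 \<noteq> 0"
  shows "F00 k = table_entry ps (0, 0) / q"
proof -
  have dom: "fst ` set ps = V k"
    using keys by (metis list.set_map set_vertices)
  have "table_entry ps v = 0" if "v \<notin> V k" for v
  proof -
    have "map_of ps v = None"
      using that by (simp add: map_of_eq_None_iff dom)
    then show ?thesis
      by (simp add: table_entry_def)
  qed
  moreover have "(v, table_entry ps v) \<in> set ps" if "v \<in> V k" for v
    using that by (auto simp: table_entry_def map_of_eq_None_iff dom split: option.split dest: map_of_SomeD)
  ultimately have "table_entry ps (0, 0) = q * walk_gf k (0, 0)"
    using step by (intro walk_gf_unique) fastforce+
  moreover have "walk_gf k (0, 0) = F00 k"
    by (simp add: walk_gf_def F00_def f00_def)
  ultimately show ?thesis
    using nonzero by auto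
qed

text \<open>For each \<open>k\<close>, \<open>ps\<close> is the certificate and \<open>q\<close> is the determinant of \<open>I - t * A\<close>. To check the
  identities, the factor \<open>t\<close> is absorbed into the powers of \<open>t\<close>, which turns them into linear
  equations between monomials.\<close>

theorem corollary2:
  shows "F00 1 = 1 / (1 - fps_X ^ 3) \<and>
    F00 2 = (1 - 3 * fps_X ^ 3) / (1 - 4 * fps_X ^ 3 - fps_X ^ 6) \<and>
    F00 3 = (1 - 8 * fps_X ^ 3 + 5 * fps_X ^ 6 - 2 * fps_X ^ 9) /
            (1 - 9 * fps_X ^ 3 + 9 * fps_X ^ 6 - 8 * fps_X ^ 9) \<and>
    F00 4 = (1 - 15 * fps_X ^ 3 + 48 * fps_X ^ 6 - 46 * fps_X ^ 9 - 19 * fps_X ^ 12) /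
            (1 - 16 * fps_X ^ 3 + 59 * fps_X ^ 6 - 67 * fps_X ^ 9 - 37 * fps_X ^ 12 + 8 * fps_X ^ 15)"
proof (intro conjI)
  show "F00 1 = 1 / (1 - fps_X ^ 3)"
  proof -
    define t :: "rat fps" where "t = fps_X"
    define ps :: "((int \<times> int) \<times> rat fps) list" where "ps =
      [((0, 0), 1),
       ((0, 1), t),
       ((1, 0), t ^ 2)]"
    define q :: "rat fps" where "q = 1 - t ^ 3"
    have "F00 1 = table_entry ps (0, 0) / q"
    proof (rule F00_eqI)
      show "map fst ps = vertices 1"
        by (simp add: ps_def vertices_def upto_rec1)
      show "\<forall>((c, d), p) \<in> set ps. p = (if (c, d) = (0, 0) then q else 0) +
          fps_X * (table_entry ps (c, d - 1) + table_entry ps (c + 1, d) + table_entry ps (c - 1, d + 1))"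
        unfolding ps_def q_def
        by (simp add: table_entry_simps cong: table_entry_weak_cong flip: t_def)
          (simp add: distrib_left right_diff_distrib mult.left_commute[of t "numeral _"]
            flip: power_Suc power2_eq_square)
    qed (simp add: q_def t_def)
    then show ?thesis
      by (simp add: table_entry_simps ps_def q_def t_def)
  qed
next
  show "F00 2 = (1 - 3 * fps_X ^ 3) / (1 - 4 * fps_X ^ 3 - fps_X ^ 6)"
  proof -
    define t :: "rat fps" where "t = fps_X"
    define ps :: "((int \<times> int) \<times> rat fps) list" where "ps =
      [((0, 0), 1 - 3 * t ^ 3),
       ((0, 1), t - t ^ 4),
       ((0, 2), t ^ 2 - t ^ 5),
       ((1, 0), t ^ 2 + t ^ 5),
       ((1, 1), 2 * t ^ 3),
       ((2, 0), 2 * t ^ 4)]"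
    define q :: "rat fps" where "q = 1 - 4 * t ^ 3 - t ^ 6"
    have "F00 2 = table_entry ps (0, 0) / q"
    proof (rule F00_eqI)
      show "map fst ps = vertices 2"
        by (simp add: ps_def vertices_def upto_rec1)
      show "\<forall>((c, d), p) \<in> set ps. p = (if (c, d) = (0, 0) then q else 0) +
          fps_X * (table_entry ps (c, d - 1) + table_entry ps (c + 1, d) + table_entry ps (c - 1, d + 1))"
        unfolding ps_def q_def
        by (simp add: table_entry_simps cong: table_entry_weak_cong flip: t_def)
          (simp add: distrib_left right_diff_distrib mult.left_commute[of t "numeral _"]
            flip: power_Suc power2_eq_square)
    qed (simp add: q_def t_def)
    then show ?thesis
      by (simp add: table_entry_simps ps_def q_def t_def)
  qed
next
  show "F00 3 = (1 - 8 * fps_X ^ 3 + 5 * fps_X ^ 6 - 2 * fps_X ^ 9) /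
    (1 - 9 * fps_X ^ 3 + 9 * fps_X ^ 6 - 8 * fps_X ^ 9)"
  proof -
    define t :: "rat fps" where "t = fps_X"
    define ps :: "((int \<times> int) \<times> rat fps) list" where "ps =
      [((0, 0), 1 - 8 * t ^ 3 + 5 * t ^ 6 - 2 * t ^ 9),
       ((0, 1), t - 6 * t ^ 4 + 3 * t ^ 7),
       ((0, 2), t ^ 2 - 3 * t ^ 5 - 2 * t ^ 8),
       ((0, 3), t ^ 3 - 3 * t ^ 6 - 2 * t ^ 9),
       ((1, 0), t ^ 2 - 4 * t ^ 5 + 6 * t ^ 8),
       ((1, 1), 2 * t ^ 3 - 2 * t ^ 6 + 2 * t ^ 9),
       ((1, 2), 3 * t ^ 4 - 5 * t ^ 7),
       ((2, 0), 2 * t ^ 4 + 3 * t ^ 7),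
       ((2, 1), 5 * t ^ 5 - 2 * t ^ 8),
       ((3, 0), 5 * t ^ 6 - 2 * t ^ 9)]"
    define q :: "rat fps" where "q = 1 - 9 * t ^ 3 + 9 * t ^ 6 - 8 * t ^ 9"
    have "F00 3 = table_entry ps (0, 0) / q"
    proof (rule F00_eqI)
      show "map fst ps = vertices 3"
        by (simp add: ps_def vertices_def upto_rec1)
      show "\<forall>((c, d), p) \<in> set ps. p = (if (c, d) = (0, 0) then q else 0) +
          fps_X * (table_entry ps (c, d - 1) + table_entry ps (c + 1, d) + table_entry ps (c - 1, d + 1))"
        unfolding ps_def q_def
        by (simp add: table_entry_simps cong: table_entry_weak_cong flip: t_def)
          (simp add: distrib_left right_diff_distrib mult.left_commute[of t "numeral _"]
            flip: power_Suc power2_eq_square)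
    qed (simp add: q_def t_def)
    then show ?thesis
      by (simp add: table_entry_simps ps_def q_def t_def)
  qed
next
  show "F00 4 = (1 - 15 * fps_X ^ 3 + 48 * fps_X ^ 6 - 46 * fps_X ^ 9 - 19 * fps_X ^ 12) /
    (1 - 16 * fps_X ^ 3 + 59 * fps_X ^ 6 - 67 * fps_X ^ 9 - 37 * fps_X ^ 12 + 8 * fps_X ^ 15)"
  proof -
    define t :: "rat fps" where "t = fps_X"
    define ps :: "((int \<times> int) \<times> rat fps) list" where "ps =
      [((0, 0), 1 - 15 * t ^ 3 + 48 * t ^ 6 - 46 * t ^ 9 - 19 * t ^ 12),
       ((0, 1), t - 13 * t ^ 4 + 32 * t ^ 7 - 16 * t ^ 10 - 6 * t ^ 13),
       ((0, 2), t ^ 2 - 10 * t ^ 5 + 19 * t ^ 8 - 15 * t ^ 11 + 4 * t ^ 14),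
       ((0, 3), t ^ 3 - 6 * t ^ 6 - 14 * t ^ 12),
       ((0, 4), t ^ 4 - 6 * t ^ 7 - 14 * t ^ 13),
       ((1, 0), t ^ 2 - 11 * t ^ 5 + 21 * t ^ 8 + 18 * t ^ 11 - 8 * t ^ 14),
       ((1, 1), 2 * t ^ 3 - 16 * t ^ 6 + 30 * t ^ 9 + 13 * t ^ 12),
       ((1, 2), 3 * t ^ 4 - 13 * t ^ 7 + t ^ 10 + 10 * t ^ 13),
       ((1, 3), 4 * t ^ 5 - 19 * t ^ 8 + t ^ 11 - 4 * t ^ 14),
       ((2, 0), 2 * t ^ 4 - 11 * t ^ 7 + 34 * t ^ 10 - 2 * t ^ 13),
       ((2, 1), 5 * t ^ 5 - 10 * t ^ 8 + 10 * t ^ 11 + 4 * t ^ 14),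
       ((2, 2), 9 * t ^ 6 - 29 * t ^ 9 + 11 * t ^ 12),
       ((3, 0), 5 * t ^ 6 + 4 * t ^ 9 - 15 * t ^ 12),
       ((3, 1), 14 * t ^ 7 - 25 * t ^ 10 - 4 * t ^ 13),
       ((4, 0), 14 * t ^ 8 - 25 * t ^ 11 - 4 * t ^ 14)]"
    define q :: "rat fps" where "q = 1 - 16 * t ^ 3 + 59 * t ^ 6 - 67 * t ^ 9 - 37 * t ^ 12 + 8 * t ^ 15"
    have "F00 4 = table_entry ps (0, 0) / q"
    proof (rule F00_eqI)
      show "map fst ps = vertices 4"
        by (simp add: ps_def vertices_def upto_rec1)
      show "\<forall>((c, d), p) \<in> set ps. p = (if (c, d) = (0, 0) then q else 0) +
          fps_X * (table_entry ps (c, d - 1) + table_entry ps (c + 1, d) + table_entry ps (c - 1, d + 1))"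
        unfolding ps_def q_def
        by (simp add: table_entry_simps cong: table_entry_weak_cong flip: t_def)
          (simp add: distrib_left right_diff_distrib mult.left_commute[of t "numeral _"]
            flip: power_Suc power2_eq_square)
    qed (simp add: q_def t_def)
    then show ?thesis
      by (simp add: table_entry_simps ps_def q_def t_def)
  qed
qed

end
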